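(* A topological flow $(X,T)$ is weakly rigid if and only if the induced flow $(E(X),T)$ on its enveloping semigroup is weakly rigid.
   Context: A (topological) flow $(X,T)$ consists of a compact Hausdorff space $X$, a topological group $T$, and a continuous map $\pi:T\times X\to X$, written $\pi(t,x)=tx$, with $(st)x=s(tx)$ and such that each $\pi^t:X\to X$, $\pi^t(x)=tx$, is a homeomorphism (so the identity of $T$ acts as the identity map). Standing assumption: the space $X$ of the given flow has no isolated points (this is not required of $E(X)$). The enveloping semigroup is $E(X)=\overline{\{\pi^t: t\in T\}}\subseteq X^X$, the closure being taken in the product topology; $T$ acts on the compact Hausdorff space $E(X)$ by $t\cdot p=\pi^t\circ p$, giving the induced flow $(E(X),T)$. For any compact Hausdorff space $Y$ with a continuous action of $T$, let $\mathcal{U}_Y$ be the unique uniformity compatible with the topology of $Y$. $(Y,T)$ is weakly rigid if for every $n\in\mathbb{N}$, all $x_1,\dots,x_n\in Y$ and every $U\in\mathcal{U}_Y$ there is $t\in T$, not acting as the identity map on $Y$, such that $(tx_i,x_i)\in U$ for all $i=1,\dots,n$. *)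

theory Defs
  imports "HOL-Analysis.Analysis" "HOL-Algebra.Group"
begin

locale topological_group = group G for G (structure) +
  fixes \<tau> :: "'g topology"
  assumes topspace_eq: "topspace \<tau> = carrier G"
    and continuous_mult: "continuous_map (prod_topology \<tau> \<tau>) \<tau> (\<lambda>(s, t). s \<otimes> t)"
    and continuous_inv: "continuous_map \<tau> \<tau> (\<lambda>t. inv t)"

locale topological_flow = topological_group G \<tau>
  for G :: "('g, 'm) monoid_scheme" (structure) and \<tau> :: "'g topology" +
  fixes X :: "'a topology" and act :: "'g \<Rightarrow> 'a \<Rightarrow> 'a"
  assumes compact: "compact_space X"
    and Hausdorff: "Hausdorff_space X"
    and continuous_act: "continuous_map (prod_topology \<tau> X) X (\<lambda>(t, x). act t x)"
    and homeomorphic_act: "t \<in> carrier G \<Longrightarrow> homeomorphic_map X X (act t)"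
    and act_mult: "\<lbrakk>s \<in> carrier G; t \<in> carrier G; x \<in> topspace X\<rbrakk>
                   \<Longrightarrow> act (s \<otimes> t) x = act s (act t x)"

definition uniformity_on_set :: "'a set \<Rightarrow> ('a \<times> 'a) set set \<Rightarrow> bool" where
  "uniformity_on_set A \<U> \<longleftrightarrow>
     \<U> \<noteq> {} \<and>
     (\<forall>U\<in>\<U>. Id_on A \<subseteq> U \<and> U \<subseteq> A \<times> A) \<and>
     (\<forall>U\<in>\<U>. \<forall>V. U \<subseteq> V \<and> V \<subseteq> A \<times> A \<longrightarrow> V \<in> \<U>) \<and>
     (\<forall>U\<in>\<U>. \<forall>V\<in>\<U>. U \<inter> V \<in> \<U>) \<and>
     (\<forall>U\<in>\<U>. U\<inverse> \<in> \<U>) \<and>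
     (\<forall>U\<in>\<U>. \<exists>V\<in>\<U>. V O V \<subseteq> U)"

definition compatible_uniformity :: "'a topology \<Rightarrow> ('a \<times> 'a) set set \<Rightarrow> bool" where
  "compatible_uniformity Y \<U> \<longleftrightarrow>
     uniformity_on_set (topspace Y) \<U> \<and>
     (\<forall>S. openin Y S \<longleftrightarrow> S \<subseteq> topspace Y \<and> (\<forall>y\<in>S. \<exists>U\<in>\<U>. U `` {y} \<subseteq> S))"

text \<open>A compact Hausdorff space has exactly one compatible uniformity; for other spaces the
  following description need not denote anything meaningful.\<close>

definition the_uniformity :: "'a topology \<Rightarrow> ('a \<times> 'a) set set" where
  "the_uniformity Y = (THE \<U>. compatible_uniformity Y \<U>)"

text \<open>The case \<open>n = 0\<close> follows from \<open>n = 1\<close> when \<open>Y\<close> is nonempty; for empty \<open>Y\<close> it makes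
  the predicate false, every element acting as the identity there.\<close>

definition weakly_rigid ::
  "('g, 'm) monoid_scheme \<Rightarrow> 'a topology \<Rightarrow> ('g \<Rightarrow> 'a \<Rightarrow> 'a) \<Rightarrow> bool" where
  "weakly_rigid G Y act \<longleftrightarrow>
     (\<forall>(n::nat) (x :: nat \<Rightarrow> 'a). (\<forall>i\<in>{1..n}. x i \<in> topspace Y) \<longrightarrow>
        (\<forall>U\<in>the_uniformity Y. \<exists>t\<in>carrier G.
           (\<exists>y\<in>topspace Y. act t y \<noteq> y) \<and> (\<forall>i\<in>{1..n}. (act t (x i), x i) \<in> U)))"

text \<open>The points of \<open>product_topology (\<lambda>_. X) (topspace X)\<close> are the maps from \<open>topspace X\<close> to
  itself, extended by \<open>undefined\<close> outside \<open>topspace X\<close>; hence the restrictions here, and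
  \<^const>\<open>compose\<close> rather than plain composition below.\<close>

definition enveloping_semigroup ::
  "('g, 'm) monoid_scheme \<Rightarrow> 'a topology \<Rightarrow> ('g \<Rightarrow> 'a \<Rightarrow> 'a) \<Rightarrow> ('a \<Rightarrow> 'a) set" where
  "enveloping_semigroup G X act =
     product_topology (\<lambda>_. X) (topspace X) closure_of
       {restrict (act t) (topspace X) | t. t \<in> carrier G}"

definition enveloping_topology ::
  "('g, 'm) monoid_scheme \<Rightarrow> 'a topology \<Rightarrow> ('g \<Rightarrow> 'a \<Rightarrow> 'a) \<Rightarrow> ('a \<Rightarrow> 'a) topology" where
  "enveloping_topology G X act =
     subtopology (product_topology (\<lambda>_. X) (topspace X)) (enveloping_semigroup G X act)"

definition enveloping_act ::
  "'a topology \<Rightarrow> ('g \<Rightarrow> 'a \<Rightarrow> 'a) \<Rightarrow> 'g \<Rightarrow> ('a \<Rightarrow> 'a) \<Rightarrow> ('a \<Rightarrow> 'a)" where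
  "enveloping_act X act t p = compose (topspace X) (act t) p"

end

theory Submission
  imports Defs
begin

text \<open>A compact Hausdorff space has exactly one compatible uniformity, the neighbourhoods of the
  diagonal, and the sections of its members are neighbourhoods of points. So weak rigidity of \<open>Y\<close>
  says that for finitely many points with prescribed neighbourhoods some \<open>t\<close>, not acting trivially,
  moves each point within its neighbourhood. A neighbourhood in \<open>E(X)\<close> constrains finitely many
  coordinates, so the condition at \<open>p\<^sub>1, \<dots>, p\<^sub>n\<close> in \<open>E(X)\<close> is implied by the condition at
  finitely many points \<open>p\<^sub>i(z\<^sub>j)\<close> of \<open>X\<close>; conversely the condition at \<open>x\<^sub>1, \<dots>, x\<^sub>n\<close> in \<open>X\<close> is
  the condition at the identity in \<open>E(X)\<close> for the coordinates \<open>x\<^sub>1, \<dots>, x\<^sub>n\<close>.\<close>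

section \<open>The uniformity of a compact Hausdorff space\<close>

text \<open>Intersect the members one at a time; nonemptiness of \<open>\<U>\<close> supplies the
  bound when \<open>I\<close> is empty. Only closure under binary intersection is assumed, so that
  this applies to the neighbourhoods of the diagonal before they are known to form a
  uniformity.\<close>

lemma finite_lower_bound_Int_closed:
  assumes "finite I" "\<U> \<noteq> {}" "\<And>U V. \<lbrakk>U \<in> \<U>; V \<in> \<U>\<rbrakk> \<Longrightarrow> U \<inter> V \<in> \<U>"
    and "\<And>i. i \<in> I \<Longrightarrow> f i \<in> \<U>"
  obtains V where "V \<in> \<U>" "\<And>i. i \<in> I \<Longrightarrow> V \<subseteq> f i"
proof -
  have "\<exists>V\<in>\<U>. \<forall>i\<in>I. V \<subseteq> f i"
    using assms(1,4)
  proof (induction I)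
    case empty
    then show ?case using assms(2) by auto
  next
    case (insert j I)
    then obtain V where "V \<in> \<U>" "\<forall>i\<in>I. V \<subseteq> f i" by auto
    with insert.prems assms(3) have "V \<inter> f j \<in> \<U>" "\<forall>i\<in>insert j I. V \<inter> f j \<subseteq> f i" by auto
    then show ?case by blast
  qed
  with that show thesis by blast
qed

lemma uniformity_on_setD:
  assumes "uniformity_on_set A \<U>" "U \<in> \<U>"
  shows "Id_on A \<subseteq> U" "U \<subseteq> A \<times> A" "U\<inverse> \<in> \<U>" "\<exists>V\<in>\<U>. V O V \<subseteq> U"
    and "\<lbrakk>U \<subseteq> V; V \<subseteq> A \<times> A\<rbrakk> \<Longrightarrow> V \<in> \<U>" "V \<in> \<U> \<Longrightarrow> U \<inter> V \<in> \<U>"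
proof -
  note props = assms(1)[unfolded uniformity_on_set_def, THEN conjunct2]
  note * = props[THEN conjunct1] props[THEN conjunct2, THEN conjunct1]
    props[THEN conjunct2, THEN conjunct2, THEN conjunct1]
    props[THEN conjunct2, THEN conjunct2, THEN conjunct2, THEN conjunct1]
    props[THEN conjunct2, THEN conjunct2, THEN conjunct2, THEN conjunct2]
  show "Id_on A \<subseteq> U" "U \<subseteq> A \<times> A" using bspec[OF *(1) assms(2)] by auto
  show "U\<inverse> \<in> \<U>" using *(4) assms(2) by (rule bspec)
  show "\<exists>V\<in>\<U>. V O V \<subseteq> U" using *(5) assms(2) by (rule bspec)
  show "\<lbrakk>U \<subseteq> V; V \<subseteq> A \<times> A\<rbrakk> \<Longrightarrow> V \<in> \<U>" using bspec[OF *(2) assms(2)] by simp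
  show "V \<in> \<U> \<Longrightarrow> U \<inter> V \<in> \<U>" using bspec[OF *(3) assms(2)] by (rule bspec)
qed

lemma uniformity_finite_lower_bound:
  assumes "uniformity_on_set A \<U>" "finite I" "\<And>i. i \<in> I \<Longrightarrow> f i \<in> \<U>"
  obtains V where "V \<in> \<U>" "\<And>i. i \<in> I \<Longrightarrow> V \<subseteq> f i"
proof (rule finite_lower_bound_Int_closed[of I \<U> f])
  show "\<U> \<noteq> {}" using assms(1) unfolding uniformity_on_set_def by (rule conjunct1)
qed (use assms(2,3) that in \<open>auto intro: uniformity_on_setD(6)[OF assms(1)]\<close>)

section \<open>The neighbourhoods of the diagonal as a compatible uniformity\<close>

definition diagonal_neighbourhoods :: "'a topology \<Rightarrow> ('a \<times> 'a) set set" where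
  "diagonal_neighbourhoods Y =
     {U. U \<subseteq> topspace Y \<times> topspace Y \<and>
       (\<exists>D. openin (prod_topology Y Y) D \<and> Id_on (topspace Y) \<subseteq> D \<and> D \<subseteq> U)}"

lemma open_in_diagonal_neighbourhoods:
  assumes "openin (prod_topology Y Y) D" "Id_on (topspace Y) \<subseteq> D"
  shows "D \<in> diagonal_neighbourhoods Y"
  using assms openin_subset[OF assms(1)] by (auto simp: diagonal_neighbourhoods_def)

lemma diagonal_neighbourhoods_Int:
  assumes "U \<in> diagonal_neighbourhoods Y" "V \<in> diagonal_neighbourhoods Y"
  shows "U \<inter> V \<in> diagonal_neighbourhoods Y"
proof -
  obtain D D' where "openin (prod_topology Y Y) D" "Id_on (topspace Y) \<subseteq> D" "D \<subseteq> U"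
    "openin (prod_topology Y Y) D'" "Id_on (topspace Y) \<subseteq> D'" "D' \<subseteq> V"
    using assms by (auto simp: diagonal_neighbourhoods_def)
  then have "openin (prod_topology Y Y) (D \<inter> D')" "Id_on (topspace Y) \<subseteq> D \<inter> D'"
    "D \<inter> D' \<subseteq> U \<inter> V" by auto
  with assms show ?thesis by (auto simp: diagonal_neighbourhoods_def)
qed

lemma diagonal_neighbourhoods_nonempty: "diagonal_neighbourhoods Y \<noteq> {}"
proof -
  have "topspace Y \<times> topspace Y \<in> diagonal_neighbourhoods Y"
    by (rule open_in_diagonal_neighbourhoods)
      (auto simp: openin_prod_Times_iff)
  then show ?thesis by blast
qed

lemma diagonal_neighbourhoods_converse:
  assumes "U \<in> diagonal_neighbourhoods Y"
  shows "U\<inverse> \<in> diagonal_neighbourhoods Y"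
proof -
  obtain D where D: "openin (prod_topology Y Y) D" "Id_on (topspace Y) \<subseteq> D" "D \<subseteq> U"
    and U: "U \<subseteq> topspace Y \<times> topspace Y"
    using assms by (auto simp: diagonal_neighbourhoods_def)
  have "openin (prod_topology Y Y) (D\<inverse>)"
    using D(1) unfolding openin_prod_topology_alt by fast
  moreover have "Id_on (topspace Y) \<subseteq> D\<inverse>" "D\<inverse> \<subseteq> U\<inverse>"
    using D by auto
  ultimately show ?thesis using U by (auto simp: diagonal_neighbourhoods_def)
qed

text \<open>Disjoint open sets \<open>A\<close>, \<open>B\<close> around \<open>x\<close>,
  \<open>z\<close> are shrunk to \<open>A'\<close>, \<open>B'\<close> inside closed sets
  \<open>C\<close>, \<open>D\<close>. Points of \<open>A'\<close> are \<open>V\<close>-related only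
  to points of \<open>A\<close>, and points of \<open>B'\<close> only to points of \<open>B\<close>.
  A pair of \<open>V O V\<close> in \<open>A' \<times> B'\<close> would thus need an intermediate
  point in both \<open>A\<close> and \<open>B\<close>.\<close>

lemma separating_diagonal_neighbourhood:
  assumes "compact_space Y" "Hausdorff_space Y"
    and "x \<in> topspace Y" "z \<in> topspace Y" "x \<noteq> z"
  obtains V N where "V \<in> diagonal_neighbourhoods Y" "openin (prod_topology Y Y) N"
    "(x, z) \<in> N" "N \<inter> (V O V) = {}"
proof -
  obtain A B where AB: "openin Y A" "openin Y B" "x \<in> A" "z \<in> B" "disjnt A B"
    using assms unfolding Hausdorff_space_def by metis
  have reg: "neighbourhood_base_of (closedin Y) Y"
    using assms compact_Hausdorff_imp_regular_space neighbourhood_base_of_closedin by blast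
  obtain A' C where A': "openin Y A'" "closedin Y C" "x \<in> A'" "A' \<subseteq> C" "C \<subseteq> A"
    using reg[unfolded neighbourhood_base_of, rule_format, OF conjI[OF AB(1,3)]] by blast
  obtain B' D where B': "openin Y B'" "closedin Y D" "z \<in> B'" "B' \<subseteq> D" "D \<subseteq> B"
    using reg[unfolded neighbourhood_base_of, rule_format, OF conjI[OF AB(2,4)]] by blast
  \<comment> \<open>Since \<open>C\<close> and \<open>D\<close> are closed subsets of
    \<open>A\<close> and \<open>B\<close>, the set \<open>R\<close> is open and \<open>A\<close>,
    \<open>B\<close>, \<open>R\<close> cover the space. Hence the three squares making up
    \<open>V\<close> contain the diagonal, while \<open>R\<close> avoids \<open>A'\<close> and
    \<open>B'\<close>.\<close>
  define R where "R = topspace Y - (C \<union> D)"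
  define V where "V = A \<times> A \<union> B \<times> B \<union> R \<times> R"
  have R: "openin Y R"
    unfolding R_def using A' B' by blast
  show thesis
  proof
    show "V \<in> diagonal_neighbourhoods Y"
    proof (rule open_in_diagonal_neighbourhoods)
      show "openin (prod_topology Y Y) V"
        unfolding V_def using AB R by (intro openin_Un) (simp_all add: openin_prod_Times_iff)
      show "Id_on (topspace Y) \<subseteq> V"
        unfolding V_def R_def using A' B' by auto
    qed
    show "openin (prod_topology Y Y) (A' \<times> B')"
      using A' B' by (simp add: openin_prod_Times_iff)
    show "(x, z) \<in> A' \<times> B'" using A' B' by blast
    show "A' \<times> B' \<inter> V O V = {}"
      using A' B' AB(5) unfolding V_def R_def disjnt_iff by blast
  qed
qed

text \<open>Compactness of the complement \<open>K\<close> of an open \<open>D\<close> inside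
  \<open>U\<close>: every point of \<open>K\<close> lies off the diagonal and has an open
  neighbourhood \<open>N k\<close> that misses \<open>V k O V k\<close>. Finitely many
  \<open>N k\<close> cover \<open>K\<close>, and the corresponding \<open>V k\<close> have a common
  lower bound \<open>W\<close>, so \<open>W O W\<close> misses \<open>K\<close>.\<close>

lemma diagonal_neighbourhoods_halving:
  assumes "compact_space Y" "Hausdorff_space Y" "U \<in> diagonal_neighbourhoods Y"
  obtains V where "V \<in> diagonal_neighbourhoods Y" "V O V \<subseteq> U"
proof -
  let ?P = "prod_topology Y Y"
  obtain D where D: "openin ?P D" "Id_on (topspace Y) \<subseteq> D" "D \<subseteq> U"
    using assms by (auto simp: diagonal_neighbourhoods_def)
  define K where "K = topspace ?P - D"
  have "compactin ?P K"
    unfolding K_def using assms(1) closedin_diff[OF closedin_topspace D(1)]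
    by (intro closedin_compact_space) (simp_all add: compact_space_prod_topology)
  have "\<exists>V N. V \<in> diagonal_neighbourhoods Y \<and> openin ?P N \<and> k \<in> N \<and> N \<inter> (V O V) = {}"
    if k_in: "k \<in> K" for k
  proof -
    obtain x z where k: "k = (x, z)" "x \<in> topspace Y" "z \<in> topspace Y" "x \<noteq> z"
      using k_in D(2) unfolding K_def by (cases k) (auto simp: Id_on_def)
    show ?thesis
      using separating_diagonal_neighbourhood[OF assms(1,2) k(2-4)] k(1) by metis
  qed
  then obtain V N where VN: "\<And>k. k \<in> K \<Longrightarrow> V k \<in> diagonal_neighbourhoods Y"
    "\<And>k. k \<in> K \<Longrightarrow> openin ?P (N k)" "\<And>k. k \<in> K \<Longrightarrow> k \<in> N k"
    "\<And>k. k \<in> K \<Longrightarrow> N k \<inter> (V k O V k) = {}"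
    by metis
  have "\<exists>\<F>. finite \<F> \<and> \<F> \<subseteq> N ` K \<and> K \<subseteq> \<Union>\<F>"
    by (rule compactinD[OF \<open>compactin ?P K\<close>]) (use VN in auto)
  then obtain K' where K': "finite K'" "K' \<subseteq> K" "K \<subseteq> (\<Union>k\<in>K'. N k)"
    by (metis finite_subset_image)
  obtain W where W: "W \<in> diagonal_neighbourhoods Y" "\<And>k. k \<in> K' \<Longrightarrow> W \<subseteq> V k"
    by (rule finite_lower_bound_Int_closed[OF K'(1), of "diagonal_neighbourhoods Y" V])
      (use K'(2) VN(1) in \<open>auto simp: diagonal_neighbourhoods_nonempty diagonal_neighbourhoods_Int\<close>)
  have "W O W \<subseteq> D"
  proof (rule ccontr)
    assume "\<not> W O W \<subseteq> D"
    then obtain p where p: "p \<in> W O W" "p \<notin> D" by blast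
    moreover have "W O W \<subseteq> topspace ?P"
      using W(1) by (auto simp: diagonal_neighbourhoods_def)
    ultimately have "p \<in> K" by (auto simp: K_def)
    then obtain k where k: "k \<in> K'" "p \<in> N k" using K'(3) by blast
    then have "p \<in> V k O V k" using p(1) W(2) by blast
    with k K'(2) VN(4) show False by blast
  qed
  with W(1) D(3) that show thesis by blast
qed

lemma compatible_diagonal_neighbourhoods:
  assumes "compact_space Y" "Hausdorff_space Y"
  shows "compatible_uniformity Y (diagonal_neighbourhoods Y)"
proof -
  have "uniformity_on_set (topspace Y) (diagonal_neighbourhoods Y)"
    unfolding uniformity_on_set_def
  proof (intro conjI ballI allI impI)
    fix U assume U: "U \<in> diagonal_neighbourhoods Y"
    then show "Id_on (topspace Y) \<subseteq> U" "U \<subseteq> topspace Y \<times> topspace Y"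
      by (auto simp: diagonal_neighbourhoods_def)
    show "V \<in> diagonal_neighbourhoods Y" if V: "U \<subseteq> V \<and> V \<subseteq> topspace Y \<times> topspace Y" for V
    proof -
      obtain D where "openin (prod_topology Y Y) D" "Id_on (topspace Y) \<subseteq> D" "D \<subseteq> U"
        using U by (auto simp: diagonal_neighbourhoods_def)
      moreover from this V have "D \<subseteq> V" by (meson order_trans)
      ultimately show ?thesis using V by (auto simp: diagonal_neighbourhoods_def)
    qed
    show "\<exists>V\<in>diagonal_neighbourhoods Y. V O V \<subseteq> U"
      by (rule diagonal_neighbourhoods_halving[OF assms U]) (rule bexI)
  qed (simp_all add: diagonal_neighbourhoods_nonempty diagonal_neighbourhoods_Int
      diagonal_neighbourhoods_converse)
  moreover have "openin Y S \<longleftrightarrow>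
      S \<subseteq> topspace Y \<and> (\<forall>y\<in>S. \<exists>U\<in>diagonal_neighbourhoods Y. U `` {y} \<subseteq> S)" for S
  proof (intro iffI conjI ballI)
    assume S: "openin Y S"
    then show "S \<subseteq> topspace Y" by (rule openin_subset)
    fix y assume y: "y \<in> S"
    \<comment> \<open>The section of this set at \<open>y\<close> is exactly \<open>S\<close>, since
      the second square omits \<open>y\<close>; that square covers the rest of the diagonal and is
      open because points are closed.\<close>
    let ?U = "S \<times> S \<union> (topspace Y - {y}) \<times> (topspace Y - {y})"
    have "closedin Y {y}"
      using assms(2) S y openin_subset by (auto intro: closedin_Hausdorff_singleton)
    then have "openin (prod_topology Y Y) ?U"
      using S by (intro openin_Un) (auto simp: openin_prod_Times_iff)
    moreover have "Id_on (topspace Y) \<subseteq> ?U" using y by auto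
    ultimately have "?U \<in> diagonal_neighbourhoods Y" by (rule open_in_diagonal_neighbourhoods)
    moreover have "?U `` {y} \<subseteq> S" by auto
    ultimately show "\<exists>U\<in>diagonal_neighbourhoods Y. U `` {y} \<subseteq> S" by blast
  next
    assume S: "S \<subseteq> topspace Y \<and> (\<forall>y\<in>S. \<exists>U\<in>diagonal_neighbourhoods Y. U `` {y} \<subseteq> S)"
    have "\<exists>T. openin Y T \<and> y \<in> T \<and> T \<subseteq> S" if y: "y \<in> S" for y
    proof -
      obtain D where D: "openin (prod_topology Y Y) D" "Id_on (topspace Y) \<subseteq> D" "D `` {y} \<subseteq> S"
        using bspec[OF conjunct2[OF S] y] unfolding diagonal_neighbourhoods_def by blast
      have "(y, y) \<in> D" using D(2) S y by auto
      then obtain A B where "openin Y A" "openin Y B" "y \<in> A" "y \<in> B" "A \<times> B \<subseteq> D"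
        using D(1) unfolding openin_prod_topology_alt by meson
      with D(3) show ?thesis by blast
    qed
    then show "openin Y S" using openin_subopen by metis
  qed
  ultimately show ?thesis unfolding compatible_uniformity_def by blast
qed

section \<open>Uniqueness of the compatible uniformity\<close>

text \<open>Compatibility only describes the open sets, so an open set inside the section has to be
  constructed. The candidate \<open>N\<close> collects the points that have a whole section inside
  the section of \<open>U\<close> at \<open>y\<close>. It is open because, if \<open>V\<close>
  witnesses \<open>x\<close> in \<open>N\<close> and \<open>W O W\<close> lies in \<open>V\<close>,
  then \<open>W\<close> witnesses every point of the section of \<open>W\<close> at
  \<open>x\<close>.\<close>

lemma compatible_uniformity_section:
  assumes "compatible_uniformity Y \<U>" "U \<in> \<U>" "y \<in> topspace Y"
  shows "\<exists>N. openin Y N \<and> y \<in> N \<and> N \<subseteq> U `` {y}"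
proof -
  have u: "uniformity_on_set (topspace Y) \<U>"
    and op: "\<And>S. openin Y S \<longleftrightarrow> S \<subseteq> topspace Y \<and> (\<forall>y\<in>S. \<exists>U\<in>\<U>. U `` {y} \<subseteq> S)"
    using assms(1) by (auto simp: compatible_uniformity_def)
  have diag: "Id_on (topspace Y) \<subseteq> V" if "V \<in> \<U>" for V
    using uniformity_on_setD(1)[OF u that] .
  define N where "N = {x \<in> topspace Y. \<exists>V\<in>\<U>. V `` {x} \<subseteq> U `` {y}}"
  show ?thesis
  proof (intro exI conjI)
    have "\<exists>V\<in>\<U>. V `` {x} \<subseteq> N" if x: "x \<in> N" for x
    proof -
      obtain V where V: "V \<in> \<U>" "V `` {x} \<subseteq> U `` {y}" using x unfolding N_def by blast
      obtain W where W: "W \<in> \<U>" "W O W \<subseteq> V"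
        using uniformity_on_setD(4)[OF u V(1)] by blast
      have "W `` {x} \<subseteq> N"
      proof
        fix w assume w: "w \<in> W `` {x}"
        then have "W `` {w} \<subseteq> U `` {y}" using W(2) V(2) by blast
        moreover have "w \<in> topspace Y" using w uniformity_on_setD(2)[OF u W(1)] by blast
        ultimately show "w \<in> N" using W(1) by (auto simp: N_def)
      qed
      with W(1) show ?thesis by blast
    qed
    then show "openin Y N" unfolding op by (auto simp: N_def)
    show "y \<in> N" using assms by (auto simp: N_def)
    show "N \<subseteq> U `` {y}"
    proof
      fix x assume "x \<in> N"
      then obtain V where V: "x \<in> topspace Y" "V \<in> \<U>" "V `` {x} \<subseteq> U `` {y}"
        by (auto simp: N_def)
      then have "(x, x) \<in> V" using diag[OF V(2)] by auto
      with V(3) show "x \<in> U `` {y}" by blast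
    qed
  qed
qed

text \<open>An entourage contains squares of neighbourhoods of all points, and their union is an
  open neighbourhood of the diagonal. The other inclusion is the Lebesgue number argument: an open
  \<open>D\<close> around the diagonal contains an entourage, obtained from a finite cover by
  compactness.\<close>

lemma compatible_uniformity_unique:
  assumes Y: "compact_space Y" and comp: "compatible_uniformity Y \<U>"
  shows "\<U> = diagonal_neighbourhoods Y"
proof -
  have u: "uniformity_on_set (topspace Y) \<U>"
    and op: "\<And>S. openin Y S \<longleftrightarrow> S \<subseteq> topspace Y \<and> (\<forall>y\<in>S. \<exists>U\<in>\<U>. U `` {y} \<subseteq> S)"
    using comp by (auto simp: compatible_uniformity_def)
  have diag: "Id_on (topspace Y) \<subseteq> V" if "V \<in> \<U>" for V
    using uniformity_on_setD(1)[OF u that] .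
  have sub: "V \<subseteq> topspace Y \<times> topspace Y" if "V \<in> \<U>" for V
    using uniformity_on_setD(2)[OF u that] .
  have half: "\<exists>V\<in>\<U>. V O V \<subseteq> U" if "U \<in> \<U>" for U
    using uniformity_on_setD(4)[OF u that] .
  have "U \<in> diagonal_neighbourhoods Y" if U: "U \<in> \<U>" for U
  proof -
    obtain V where V: "V \<in> \<U>" "V O V \<subseteq> U" using half[OF U] by blast
    \<comment> \<open>Symmetry lets two points of one section be joined through its centre: if both
      are \<open>W\<close>-related to \<open>y\<close>, the pair lies in \<open>V O V\<close> and
      hence in \<open>U\<close>.\<close>
    define W where "W = V \<inter> V\<inverse>"
    have W: "W \<in> \<U>" unfolding W_def by (rule uniformity_on_setD(6)[OF u V(1) uniformity_on_setD(3)[OF u V(1)]])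
    obtain N where N: "\<And>y. y \<in> topspace Y \<Longrightarrow> openin Y (N y)"
      "\<And>y. y \<in> topspace Y \<Longrightarrow> y \<in> N y" "\<And>y. y \<in> topspace Y \<Longrightarrow> N y \<subseteq> W `` {y}"
      using compatible_uniformity_section[OF comp W] by metis
    let ?D = "\<Union>y\<in>topspace Y. N y \<times> N y"
    have "openin (prod_topology Y Y) ?D"
      using N(1) by (intro openin_Union) (auto simp: openin_prod_Times_iff)
    moreover have "Id_on (topspace Y) \<subseteq> ?D" using N(2) by auto
    moreover have "?D \<subseteq> U"
    proof (rule UN_least)
      fix y assume "y \<in> topspace Y"
      from N(3)[OF this] V(2) show "N y \<times> N y \<subseteq> U" unfolding W_def by blast
    qed
    ultimately show ?thesis
      using sub[OF U] by (auto simp: diagonal_neighbourhoods_def)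
  qed
  moreover have "U \<in> \<U>" if U: "U \<in> diagonal_neighbourhoods Y" for U
  proof -
    obtain D where D: "openin (prod_topology Y Y) D" "Id_on (topspace Y) \<subseteq> D" "D \<subseteq> U"
      and UY: "U \<subseteq> topspace Y \<times> topspace Y"
      using U by (auto simp: diagonal_neighbourhoods_def)
    \<comment> \<open>Two \<open>V\<close>-steps from \<open>y\<close> stay in a square inside
      \<open>D\<close>. The first step is spent on reaching a point of the covering set
      \<open>N\<close>, the second is left for a pair in the final entourage
      \<open>W\<close>.\<close>
    have "\<exists>V N. V \<in> \<U> \<and> openin Y N \<and> y \<in> N \<and> N \<subseteq> V `` {y} \<and>
        (V O V) `` {y} \<times> (V O V) `` {y} \<subseteq> D" if y: "y \<in> topspace Y" for y
    proof -
      have "(y, y) \<in> D" using D(2) y by auto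
      then obtain A B where "openin Y A" "openin Y B" "y \<in> A" "y \<in> B" "A \<times> B \<subseteq> D"
        using D(1) unfolding openin_prod_topology_alt by meson
      then have AB: "openin Y (A \<inter> B)" "y \<in> A \<inter> B" "(A \<inter> B) \<times> (A \<inter> B) \<subseteq> D" by auto
      obtain U' where U': "U' \<in> \<U>" "U' `` {y} \<subseteq> A \<inter> B"
        using bspec[OF conjunct2[OF iffD1[OF op AB(1)]] AB(2)] by blast
      obtain V where V: "V \<in> \<U>" "V O V \<subseteq> U'" using half[OF U'(1)] by blast
      obtain N where N: "openin Y N" "y \<in> N" "N \<subseteq> V `` {y}"
        using compatible_uniformity_section[OF comp V(1) y] by blast
      have "(V O V) `` {y} \<times> (V O V) `` {y} \<subseteq> D" using U'(2) V(2) AB(3) by blast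
      with V(1) N show ?thesis by blast
    qed
    then obtain V N where VN: "\<And>y. y \<in> topspace Y \<Longrightarrow> V y \<in> \<U>"
      "\<And>y. y \<in> topspace Y \<Longrightarrow> openin Y (N y)" "\<And>y. y \<in> topspace Y \<Longrightarrow> y \<in> N y"
      "\<And>y. y \<in> topspace Y \<Longrightarrow> N y \<subseteq> V y `` {y}"
      "\<And>y. y \<in> topspace Y \<Longrightarrow> (V y O V y) `` {y} \<times> (V y O V y) `` {y} \<subseteq> D"
      by metis
    have "\<exists>\<F>. finite \<F> \<and> \<F> \<subseteq> N ` topspace Y \<and> topspace Y \<subseteq> \<Union>\<F>"
      by (rule compactinD[OF Y[unfolded compact_space_def]]) (use VN in auto)
    then obtain F where F: "finite F" "F \<subseteq> topspace Y" "topspace Y \<subseteq> (\<Union>y\<in>F. N y)"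
      by (metis finite_subset_image)
    obtain W where W: "W \<in> \<U>" "\<And>y. y \<in> F \<Longrightarrow> W \<subseteq> V y"
      by (rule uniformity_finite_lower_bound[OF u F(1), of V]) (use F(2) VN(1) in auto)
    have "W \<subseteq> D"
    proof (rule subrelI)
      fix a b assume ab: "(a, b) \<in> W"
      then have "a \<in> topspace Y" using sub[OF W(1)] by blast
      then obtain y where y: "y \<in> F" "a \<in> N y" using F(3) by blast
      then have yY: "y \<in> topspace Y" using F(2) by blast
      have "(y, a) \<in> V y" using VN(4)[OF yY] y(2) by blast
      moreover have "(a, b) \<in> V y" using W(2)[OF y(1)] ab by blast
      \<comment> \<open>Reflexivity pads the single step from \<open>y\<close> to \<open>a\<close>
        to two steps, so that both \<open>a\<close> and \<open>b\<close> lie in the section of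
        \<open>V y O V y\<close> at \<open>y\<close>.\<close>
      moreover have "(y, y) \<in> V y" using diag[OF VN(1)[OF yY]] yY by auto
      ultimately show "(a, b) \<in> D" using VN(5)[OF yY] by blast
    qed
    then show "U \<in> \<U>"
      using D(3) by (intro uniformity_on_setD(5)[OF u W(1) _ UY]) blast
  qed
  ultimately show ?thesis by blast
qed

text \<open>Existence and uniqueness together make the definite description denote.\<close>

lemma compatible_the_uniformity:
  assumes "compact_space Y" "Hausdorff_space Y"
  shows "compatible_uniformity Y (the_uniformity Y)"
  unfolding the_uniformity_def
  using compatible_diagonal_neighbourhoods[OF assms] compatible_uniformity_unique[OF assms(1)]
  by (rule theI)

section \<open>Weak rigidity in terms of neighbourhoods\<close>

text \<open>Prescribed neighbourhoods of finitely many points contain sections of entourages, which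
  have a common lower bound; conversely, the sections of one entourage contain open neighbourhoods.
  This form replaces sequences by finite sets and lets the neighbourhood depend on the
  point.\<close>

lemma weakly_rigid_iff_neighbourhoods:
  assumes "compact_space Y" "Hausdorff_space Y"
  shows "weakly_rigid G Y act \<longleftrightarrow>
    (\<forall>F W. finite F \<and> F \<subseteq> topspace Y \<and> (\<forall>x\<in>F. openin Y (W x) \<and> x \<in> W x) \<longrightarrow>
      (\<exists>t\<in>carrier G. (\<exists>y\<in>topspace Y. act t y \<noteq> y) \<and> (\<forall>x\<in>F. act t x \<in> W x)))"
    (is "_ \<longleftrightarrow> ?R")
proof
  let ?\<U> = "the_uniformity Y"
  have comp: "compatible_uniformity Y ?\<U>" by (rule compatible_the_uniformity[OF assms])
  then have u: "uniformity_on_set (topspace Y) ?\<U>"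
    and op: "\<And>S. openin Y S \<longleftrightarrow> S \<subseteq> topspace Y \<and> (\<forall>y\<in>S. \<exists>U\<in>?\<U>. U `` {y} \<subseteq> S)"
    by (auto simp: compatible_uniformity_def)
  \<comment> \<open>Weak rigidity puts \<open>(act t x, x)\<close> in the entourage, whereas a
    section at \<open>x\<close> consists of second components of pairs starting with
    \<open>x\<close>; the converse reconciles the two.\<close>
  have conv: "U\<inverse> \<in> ?\<U>" if "U \<in> ?\<U>" for U
    using uniformity_on_setD(3)[OF u that] .
  {
    assume wr: "weakly_rigid G Y act"
    show ?R
    proof (intro allI impI, elim conjE)
      fix F W
      assume F: "finite F" "F \<subseteq> topspace Y" and W: "\<forall>x\<in>F. openin Y (W x) \<and> x \<in> W x"
      have "\<exists>U\<in>?\<U>. U `` {x} \<subseteq> W x" if "x \<in> F" for x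
        using W that unfolding op by blast
      then obtain U where U: "\<And>x. x \<in> F \<Longrightarrow> U x \<in> ?\<U>" "\<And>x. x \<in> F \<Longrightarrow> U x `` {x} \<subseteq> W x"
        by metis
      obtain V where V: "V \<in> ?\<U>" "\<And>x. x \<in> F \<Longrightarrow> V \<subseteq> U x"
        by (rule uniformity_finite_lower_bound[OF u F(1), of U]) (use U(1) in auto)
      obtain n :: nat and e where e: "F = e ` {i. i < n}"
        using finite_imp_nat_seg_image_inj_on[OF F(1)] by blast
      \<comment> \<open>The enumeration \<open>e\<close> starts at 0, the points in the definition
        of weak rigidity at 1.\<close>
      define x where "x i = e (i - 1)" for i
      have x: "F = x ` {1..n}"
      proof -
        have "x ` {1..n} = e ` ((\<lambda>i. i - 1) ` {1..n})" by (auto simp: x_def image_image)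
        also have "(\<lambda>i. i - 1) ` {1..n} = {i. i < n}"
          by (auto simp: image_iff intro!: bexI[of _ "Suc _"])
        finally show ?thesis using e by simp
      qed
      have "\<forall>i\<in>{1..n}. x i \<in> topspace Y" using F(2) x by blast
      then obtain t where t: "t \<in> carrier G" "\<exists>y\<in>topspace Y. act t y \<noteq> y"
        "\<forall>i\<in>{1..n}. (act t (x i), x i) \<in> V\<inverse>"
        using wr[unfolded weakly_rigid_def, THEN spec, THEN spec, THEN mp,
            THEN bspec, OF _ conv[OF V(1)]] by blast
      have "act t y \<in> W y" if y: "y \<in> F" for y
      proof -
        obtain i where i: "y = x i" "i \<in> {1..n}" using y[unfolded x] by (rule imageE)
        have "(y, act t y) \<in> V" using bspec[OF t(3) i(2)] i(1) by simp
        with V(2)[OF y] U(2)[OF y] show ?thesis by blast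
      qed
      with t show "\<exists>t\<in>carrier G. (\<exists>y\<in>topspace Y. act t y \<noteq> y) \<and> (\<forall>x\<in>F. act t x \<in> W x)"
        by blast
    qed
  }
  assume R: ?R
  show "weakly_rigid G Y act"
    unfolding weakly_rigid_def
  proof (intro allI impI ballI)
    fix n :: nat and x :: "nat \<Rightarrow> 'a" and U
    assume x: "\<forall>i\<in>{1..n}. x i \<in> topspace Y" and U: "U \<in> ?\<U>"
    obtain N where N: "\<And>y. y \<in> topspace Y \<Longrightarrow> openin Y (N y)"
      "\<And>y. y \<in> topspace Y \<Longrightarrow> y \<in> N y" "\<And>y. y \<in> topspace Y \<Longrightarrow> N y \<subseteq> U\<inverse> `` {y}"
      using compatible_uniformity_section[OF comp conv[OF U]] by metis
    have "finite (x ` {1..n}) \<and> x ` {1..n} \<subseteq> topspace Y \<and>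
        (\<forall>y\<in>x ` {1..n}. openin Y (N y) \<and> y \<in> N y)"
      using x N(1,2) by auto
    then obtain t where t: "t \<in> carrier G" "\<exists>y\<in>topspace Y. act t y \<noteq> y"
      "\<forall>y\<in>x ` {1..n}. act t y \<in> N y"
      using R[rule_format, of "x ` {1..n}" N] by blast
    have "(act t (x i), x i) \<in> U" if "i \<in> {1..n}" for i
      using N(3)[OF bspec[OF x that]] t(3) that by blast
    with t show "\<exists>t\<in>carrier G. (\<exists>y\<in>topspace Y. act t y \<noteq> y) \<and>
        (\<forall>i\<in>{1..n}. (act t (x i), x i) \<in> U)"
      by blast
  qed
qed

section \<open>The enveloping semigroup\<close>

lemma topspace_enveloping:
  "topspace (enveloping_topology G X act) = enveloping_semigroup G X act"
  unfolding enveloping_topology_def enveloping_semigroup_def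
  by (rule topspace_subtopology_subset[OF closure_of_subset_topspace])

text \<open>Tychonoff's theorem, together with the fact that a closure is closed in the product; the
  Hausdorff property passes to products and subspaces.\<close>

lemma compact_Hausdorff_enveloping:
  assumes "compact_space X" "Hausdorff_space X"
  shows "compact_space (enveloping_topology G X act)"
    and "Hausdorff_space (enveloping_topology G X act)"
proof -
  show "compact_space (enveloping_topology G X act)"
    unfolding enveloping_topology_def enveloping_semigroup_def
    using assms(1)
    by (intro compact_space_subtopology closedin_compact_space)
      (auto simp: compact_space_product_topology)
  show "Hausdorff_space (enveloping_topology G X act)"
    unfolding enveloping_topology_def
    using assms(2) by (intro Hausdorff_space_subtopology)
      (auto simp: Hausdorff_space_product_topology)
qed

lemma enveloping_semigroup_PiE:
  assumes "p \<in> enveloping_semigroup G X act"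
  shows "p \<in> topspace X \<rightarrow>\<^sub>E topspace X"
  using assms closure_of_subset_topspace[of "product_topology (\<lambda>_. X) (topspace X)"]
  unfolding enveloping_semigroup_def by fastforce

section \<open>The action of the group on the enveloping semigroup\<close>

context topological_flow
begin

lemma act_in: "\<lbrakk>t \<in> carrier G; x \<in> topspace X\<rbrakk> \<Longrightarrow> act t x \<in> topspace X"
  using homeomorphic_act homeomorphic_imp_surjective_map by blast

text \<open>Surjectivity of \<open>act \<one>\<close> gives \<open>x = act \<one> y\<close>, and
  \<open>\<one> \<otimes> \<one> = \<one>\<close> makes this map idempotent, so it fixes
  \<open>x\<close>.\<close>

lemma act_one:
  assumes "x \<in> topspace X"
  shows "act \<one> x = x"
proof -
  obtain y where "y \<in> topspace X" "x = act \<one> y"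
    using homeomorphic_imp_surjective_map[OF homeomorphic_act[OF one_closed]] assms by blast
  then show ?thesis using act_mult[of \<one> \<one> y] by simp
qed

lemma restrict_act_in_enveloping:
  assumes "t \<in> carrier G"
  shows "restrict (act t) (topspace X) \<in> enveloping_semigroup G X act"
proof -
  have "{restrict (act t) (topspace X) | t. t \<in> carrier G}
      \<subseteq> topspace (product_topology (\<lambda>_. X) (topspace X))"
    using act_in by auto
  from closure_of_subset[OF this] assms show ?thesis
    unfolding enveloping_semigroup_def by blast
qed

lemma identity_in_enveloping: "restrict (\<lambda>x. x) (topspace X) \<in> enveloping_semigroup G X act"
proof -
  have "restrict (act \<one>) (topspace X) = restrict (\<lambda>x. x) (topspace X)"
    using act_one by (intro restrict_ext)
  then show ?thesis using restrict_act_in_enveloping[OF one_closed] by simp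
qed

lemma enveloping_act_apply:
  "x \<in> topspace X \<Longrightarrow> enveloping_act X act t p x = act t (p x)"
  by (simp add: enveloping_act_def compose_def)

text \<open>Composition with \<open>act t\<close> on the left is continuous coordinatewise and sends
  the translation by \<open>s\<close> to the translation by \<open>t \<otimes> s\<close>. It
  therefore maps the set of translations into itself, and hence also its closure.\<close>

lemma enveloping_act_in:
  assumes t: "t \<in> carrier G" and p: "p \<in> enveloping_semigroup G X act"
  shows "enveloping_act X act t p \<in> enveloping_semigroup G X act"
proof -
  let ?P = "product_topology (\<lambda>_. X) (topspace X)"
  let ?S = "{restrict (act t) (topspace X) | t. t \<in> carrier G}"
  have "continuous_map ?P ?P (enveloping_act X act t)"
    unfolding continuous_map_componentwise
  proof (intro conjI ballI)
    show "enveloping_act X act t ` topspace ?P \<subseteq> extensional (topspace X)"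
      by (auto simp: enveloping_act_def)
    fix x assume x: "x \<in> topspace X"
    have "continuous_map ?P X (act t \<circ> (\<lambda>p. p x))"
      using x by (intro continuous_map_compose[of _ X] continuous_map_product_projection
          homeomorphic_imp_continuous_map homeomorphic_act t)
    then show "continuous_map ?P X (\<lambda>p. enveloping_act X act t p x)"
      by (simp add: enveloping_act_apply[OF x] o_def)
  qed
  then have "enveloping_act X act t ` (?P closure_of ?S)
      \<subseteq> ?P closure_of (enveloping_act X act t ` ?S)"
    by (rule continuous_map_image_closure_subset)
  also have "\<dots> \<subseteq> ?P closure_of ?S"
  proof (rule closure_of_mono, clarify)
    fix s assume s: "s \<in> carrier G"
    have "enveloping_act X act t (restrict (act s) (topspace X))
        = restrict (act (t \<otimes> s)) (topspace X)"
      using s t act_mult by (auto simp: enveloping_act_def compose_def fun_eq_iff)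
    then show "\<exists>r. enveloping_act X act t (restrict (act s) (topspace X))
        = restrict (act r) (topspace X) \<and> r \<in> carrier G"
      using s t by blast
  qed
  finally show ?thesis using p unfolding enveloping_semigroup_def by blast
qed

text \<open>If \<open>t\<close> moves \<open>p\<close>, the two maps differ at some coordinate
  \<open>x\<close>, so \<open>t\<close> moves the point \<open>p x\<close>. Conversely, if
  \<open>t\<close> moves a point of \<open>X\<close>, it moves the identity of the
  semigroup.\<close>

lemma enveloping_act_nontrivial_iff:
  "(\<exists>p\<in>enveloping_semigroup G X act. enveloping_act X act t p \<noteq> p) \<longleftrightarrow>
    (\<exists>x\<in>topspace X. act t x \<noteq> x)"
proof
  assume "\<exists>p\<in>enveloping_semigroup G X act. enveloping_act X act t p \<noteq> p"
  then obtain p where p: "p \<in> enveloping_semigroup G X act" "enveloping_act X act t p \<noteq> p"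
    by blast
  have "p \<in> topspace X \<rightarrow>\<^sub>E topspace X" by (rule enveloping_semigroup_PiE[OF p(1)])
  moreover have "enveloping_act X act t p \<in> extensional (topspace X)"
    by (simp add: enveloping_act_def)
  ultimately obtain x where "x \<in> topspace X" "enveloping_act X act t p x \<noteq> p x"
    using p(2) by (metis PiE_iff extensionalityI)
  with \<open>p \<in> topspace X \<rightarrow>\<^sub>E topspace X\<close> show "\<exists>x\<in>topspace X. act t x \<noteq> x"
    by (auto simp: enveloping_act_apply)
next
  assume "\<exists>x\<in>topspace X. act t x \<noteq> x"
  then obtain x where x: "x \<in> topspace X" "act t x \<noteq> x" by blast
  then have "enveloping_act X act t (restrict (\<lambda>x. x) (topspace X)) x
      \<noteq> restrict (\<lambda>x. x) (topspace X) x"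
    by (simp add: enveloping_act_apply)
  then show "\<exists>p\<in>enveloping_semigroup G X act. enveloping_act X act t p \<noteq> p"
    using identity_in_enveloping by metis
qed

section \<open>Transfer of weak rigidity between the flow and its enveloping semigroup\<close>

lemma weakly_rigid_enveloping:
  assumes "weakly_rigid G X act"
  shows "weakly_rigid G (enveloping_topology G X act) (enveloping_act X act)"
  unfolding weakly_rigid_iff_neighbourhoods[OF compact_Hausdorff_enveloping[OF compact Hausdorff]]
    topspace_enveloping
proof (intro allI impI, elim conjE)
  let ?P = "product_topology (\<lambda>_. X) (topspace X)"
  fix F W
  assume F: "finite F" "F \<subseteq> enveloping_semigroup G X act"
    and W: "\<forall>p\<in>F. openin (enveloping_topology G X act) (W p) \<and> p \<in> W p"
  \<comment> \<open>\<open>B\<close> is a basic open box around \<open>p\<close> that restricts only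
    finitely many coordinates and whose trace on the semigroup lies in \<open>W p\<close>.\<close>
  let ?Q = "\<lambda>p B. finite {z \<in> topspace X. B z \<noteq> topspace X} \<and>
      (\<forall>z\<in>topspace X. openin X (B z)) \<and> p \<in> Pi\<^sub>E (topspace X) B \<and>
      Pi\<^sub>E (topspace X) B \<inter> enveloping_semigroup G X act \<subseteq> W p"
  have "\<forall>p\<in>F. \<exists>B. ?Q p B"
  proof
    fix p assume p: "p \<in> F"
    obtain T where T: "openin ?P T" "W p = T \<inter> enveloping_semigroup G X act"
      using W p unfolding enveloping_topology_def openin_subtopology by blast
    have "p \<in> T" using W T(2) p by blast
    with T(1) obtain B where "finite {z \<in> topspace X. B z \<noteq> topspace X}"
      "\<forall>z\<in>topspace X. openin X (B z)" "p \<in> Pi\<^sub>E (topspace X) B" "Pi\<^sub>E (topspace X) B \<subseteq> T"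
      unfolding openin_product_topology_alt by meson
    with T(2) show "\<exists>B. ?Q p B" by blast
  qed
  from bchoice[OF this] obtain B where "\<forall>p\<in>F. ?Q p (B p)" by (rule exE)
  then have B: "\<And>p. p \<in> F \<Longrightarrow> finite {z \<in> topspace X. B p z \<noteq> topspace X}"
    "\<And>p z. \<lbrakk>p \<in> F; z \<in> topspace X\<rbrakk> \<Longrightarrow> openin X (B p z)"
    "\<And>p. p \<in> F \<Longrightarrow> p \<in> Pi\<^sub>E (topspace X) (B p)"
    "\<And>p. p \<in> F \<Longrightarrow> Pi\<^sub>E (topspace X) (B p) \<inter> enveloping_semigroup G X act \<subseteq> W p"
    by blast+
  \<comment> \<open>These are the finitely many pairs of a map and a coordinate that carry a real
    constraint; their values \<open>p z\<close> form the finite set \<open>H\<close> to which weak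
    rigidity of \<open>X\<close> is applied.\<close>
  define I where "I = (SIGMA p:F. {z \<in> topspace X. B p z \<noteq> topspace X})"
  have I: "finite I" unfolding I_def using F(1) B(1) by (intro finite_SigmaI)
  define H where "H = (\<lambda>(p, z). p z) ` I"
  \<comment> \<open>The same point may arise as \<open>p z\<close> for several pairs \<open>(p, z)\<close>; intersect their constraints.\<close>
  define N where
    "N x = topspace X \<inter> (\<Inter>(p, z)\<in>{(p, z) \<in> I. p z = x}. B p z)" for x
  have val: "p z \<in> topspace X" if "p \<in> F" "z \<in> topspace X" for p z
    using PiE_mem[OF enveloping_semigroup_PiE[OF subsetD[OF F(2) that(1)]] that(2)] .
  have "finite H \<and> H \<subseteq> topspace X \<and> (\<forall>x\<in>H. openin X (N x) \<and> x \<in> N x)"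
  proof (intro conjI ballI)
    show "finite H" unfolding H_def using I by simp
    show HX: "H \<subseteq> topspace X" unfolding H_def I_def using val by auto
    fix x assume x: "x \<in> H"
    let ?J = "{(p, z) \<in> I. p z = x}"
    have J: "finite ?J" by (rule finite_subset[OF _ I]) auto
    show "openin X (N x)"
      unfolding N_def
    proof (rule openin_Int_Inter)
      show "finite ((\<lambda>(p, z). B p z) ` ?J)" using J by simp
      show "openin X S" if "S \<in> (\<lambda>(p, z). B p z) ` ?J" for S
        using that B(2) unfolding I_def by auto
    qed auto
    have "x \<in> B p z" if "(p, z) \<in> ?J" for p z
      using that PiE_mem[OF B(3)] unfolding I_def by auto
    then show "x \<in> N x" unfolding N_def using x HX by auto
  qed
  then obtain t where t: "t \<in> carrier G" "\<exists>x\<in>topspace X. act t x \<noteq> x" "\<forall>x\<in>H. act t x \<in> N x"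
    using assms[unfolded weakly_rigid_iff_neighbourhoods[OF compact Hausdorff],
        THEN spec[of _ H], THEN spec[of _ N], THEN mp] by blast
  have "enveloping_act X act t p \<in> W p" if p: "p \<in> F" for p
  proof -
    \<comment> \<open>Unrestricted coordinates cause no trouble, since \<open>act t\<close>
      preserves the space; the restricted ones are controlled by \<open>N\<close> at
      \<open>p z\<close>.\<close>
    have "act t (p z) \<in> B p z" if z: "z \<in> topspace X" for z
    proof (cases "B p z = topspace X")
      case True
      then show ?thesis using act_in[OF t(1) val[OF p z]] by simp
    next
      case False
      then have pz: "(p, z) \<in> I" unfolding I_def using p z by simp
      then have "p z \<in> H" unfolding H_def by force
      then have "act t (p z) \<in> N (p z)" using t(3) by blast
      with pz show ?thesis unfolding N_def by blast
    qed
    then have "enveloping_act X act t p \<in> Pi\<^sub>E (topspace X) (B p)"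
      unfolding enveloping_act_def compose_def by auto
    with B(4)[OF p] enveloping_act_in[OF t(1)] F(2) p show ?thesis by blast
  qed
  with t(1,2) show "\<exists>t\<in>carrier G.
      (\<exists>p\<in>enveloping_semigroup G X act. enveloping_act X act t p \<noteq> p) \<and>
      (\<forall>p\<in>F. enveloping_act X act t p \<in> W p)"
    unfolding enveloping_act_nontrivial_iff by blast
qed

text \<open>One point of the semigroup suffices: the value of \<open>t\<close> applied to the
  identity at coordinate \<open>x\<close> is \<open>act t x\<close>, so finitely many conditions on
  points of \<open>X\<close> become a single basic neighbourhood of the identity.\<close>

lemma weakly_rigid_if_enveloping:
  assumes "weakly_rigid G (enveloping_topology G X act) (enveloping_act X act)"
  shows "weakly_rigid G X act"
  unfolding weakly_rigid_iff_neighbourhoods[OF compact Hausdorff]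
proof (intro allI impI, elim conjE)
  let ?P = "product_topology (\<lambda>_. X) (topspace X)" and ?E = "enveloping_semigroup G X act"
  let ?id = "restrict (\<lambda>x. x) (topspace X)"
  fix F W
  assume F: "finite F" "F \<subseteq> topspace X" and W: "\<forall>x\<in>F. openin X (W x) \<and> x \<in> W x"
  \<comment> \<open>Coordinates outside \<open>F\<close> are left free, so that finiteness of
    \<open>F\<close> makes the box open in the product topology.\<close>
  define B where "B z = (if z \<in> F then W z else topspace X)" for z
  have "openin ?P (Pi\<^sub>E (topspace X) B)"
    using W by (intro product_topology_basis finite_subset[OF _ F(1)]) (auto simp: B_def)
  then have "openin (enveloping_topology G X act) (Pi\<^sub>E (topspace X) B \<inter> ?E)"
    unfolding enveloping_topology_def by (rule openin_subtopology_Int)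
  moreover have "?id \<in> Pi\<^sub>E (topspace X) B \<inter> ?E"
    using identity_in_enveloping W by (auto simp: B_def)
  ultimately have "finite {?id} \<and> {?id} \<subseteq> ?E \<and>
      (\<forall>p\<in>{?id}. openin (enveloping_topology G X act) (Pi\<^sub>E (topspace X) B \<inter> ?E)
        \<and> p \<in> Pi\<^sub>E (topspace X) B \<inter> ?E)"
    by simp
  moreover note assms[unfolded weakly_rigid_iff_neighbourhoods[OF
        compact_Hausdorff_enveloping[OF compact Hausdorff]] topspace_enveloping, rule_format,
      of "{?id}" "\<lambda>_. Pi\<^sub>E (topspace X) B \<inter> ?E"]
  ultimately obtain t where t: "t \<in> carrier G" "\<exists>p\<in>?E. enveloping_act X act t p \<noteq> p"
    "enveloping_act X act t ?id \<in> Pi\<^sub>E (topspace X) B"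
    by blast
  have "act t x \<in> W x" if "x \<in> F" for x
    using PiE_mem[OF t(3), of x] that F(2) by (auto simp: enveloping_act_apply B_def)
  with t(1,2) show "\<exists>t\<in>carrier G. (\<exists>y\<in>topspace X. act t y \<noteq> y) \<and> (\<forall>x\<in>F. act t x \<in> W x)"
    unfolding enveloping_act_nontrivial_iff by blast
qed

end

theorem theorem11:
  fixes G :: "('g, 'm) monoid_scheme" and \<tau> :: "'g topology"
    and X :: "'a topology" and act :: "'g \<Rightarrow> 'a \<Rightarrow> 'a"
  assumes "topological_flow G \<tau> X act"
    and "\<forall>x\<in>topspace X. \<not> openin X {x}"
  shows "weakly_rigid G X act \<longleftrightarrow>
         weakly_rigid G (enveloping_topology G X act) (enveloping_act X act)"
  using topological_flow.weakly_rigid_enveloping[OF assms(1)]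
    topological_flow.weakly_rigid_if_enveloping[OF assms(1)]
  by blast

end
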